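(* Let $G$ be a discrete group, $p\in[1,\infty)$, and let $\mathcal{X}$ be a Banach space. A $p$-USF $(\{f_g\}_{g\in G},\{\tau_g\}_{g\in G})$ for $\mathcal{X}$ is a group-$p$-USF for $\mathcal{X}$ if and only if its Gramian $G_{f,\tau}=\theta_f\theta_\tau$, whose matrix with respect to the standard Schauder basis of $\ell^p(G)$ is $[f_g(\tau_h)]_{g,h\in G}$, is a group-matrix.
   Context: Banach spaces are over $\mathbb{C}$ and separable; $\mathcal{X}^*$ is the dual of $\mathcal{X}$. A discrete group is a countable group with the discrete topology (not necessarily abelian). $\mathcal{II}(\mathcal{X})$ is the set of invertible (surjective) linear isometries of $\mathcal{X}$. An invertible isometric representation of a discrete group $G$ on $\mathcal{X}$ is a group homomorphism $\pi:G\to\mathcal{II}(\mathcal{X})$, $g\mapsto\pi_g$. An unconditional Schauder frame (USF) for $\mathcal{X}$ is a pair $(\{f_g\}_{g\in G},\{\tau_g\}_{g\in G})$ with $f_g\in\mathcal{X}^*$, $\tau_g\in\mathcal{X}$ such that $x=\sum_{g\in G}f_g(x)\tau_g$ for all $x\in\mathcal{X}$, with unconditional convergence. A USF is a $p$-USF if (i) the analysis operator $\theta_f:\mathcal{X}\to\ell^p(G)$, $\theta_fx=\{f_g(x)\}_{g\in G}$, is a well-defined isometry, and (ii) the synthesis operator $\theta_\tau:\ell^p(G)\to\mathcal{X}$, $\theta_\tau\{a_g\}_{g\in G}=\sum_{g\in G}a_g\tau_g$, is a well-defined bounded linear operator. A $p$-USF is a group-$p$-USF if there exist an invertible isometric representation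 $\pi$ of $G$ on $\mathcal{X}$, $\tau\in\mathcal{X}$ and $f\in\mathcal{X}^*$ such that $f_g=f\pi_{g^{-1}}$ and $\tau_g=\pi_g\tau$ for all $g\in G$. A matrix $[a_{g,h}]_{g,h\in G}$ over $\mathbb{C}$ is a group-matrix if there exists a function $\nu:G\to\mathbb{C}$ such that $a_{g,h}=\nu(g^{-1}h)$ for all $g,h\in G$. *)

theory Defs
  imports "HOL-Analysis.Analysis" "HOL-Algebra.Group"
begin

section \<open>Complex Banach spaces\<close>

text \<open>The underlying real Banach space is that of the class \<open>banach\<close>; its scalar
  multiplication is required to be the restriction of the complex one.\<close>

class complex_banach = banach +
  fixes scaleC :: "complex \<Rightarrow> 'a \<Rightarrow> 'a"  (infixr "*\<^sub>C" 75)
  assumes scaleC_add_right: "c *\<^sub>C (x + y) = c *\<^sub>C x + c *\<^sub>C y"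
    and scaleC_add_left: "(c + d) *\<^sub>C x = c *\<^sub>C x + d *\<^sub>C x"
    and scaleC_scaleC: "c *\<^sub>C d *\<^sub>C x = (c * d) *\<^sub>C x"
    and scaleC_one: "1 *\<^sub>C x = x"
    and scaleC_of_real: "complex_of_real r *\<^sub>C x = r *\<^sub>R x"
    and norm_scaleC: "norm (c *\<^sub>C x) = cmod c * norm x"

instantiation complex :: complex_banach
begin

definition scaleC_complex :: "complex \<Rightarrow> complex \<Rightarrow> complex"
  where "scaleC_complex c x = c * x"

instance
  by standard
    (simp_all add: scaleC_complex_def algebra_simps scaleR_conv_of_real norm_mult)

end

definition bounded_clinear :: "('a::complex_banach \<Rightarrow> 'b::complex_banach) \<Rightarrow> bool"
  where "bounded_clinear T \<longleftrightarrow> bounded_linear T \<and> (\<forall>c x. T (c *\<^sub>C x) = c *\<^sub>C T x)"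

definition dual :: "('a::complex_banach \<Rightarrow> complex) set"
  where "dual = {\<phi>. bounded_clinear \<phi>}"

section \<open>Invertible isometric representations\<close>

definition invertible_isometries :: "('a::complex_banach \<Rightarrow> 'a) set"
  where "invertible_isometries =
    {T. bounded_clinear T \<and> (\<forall>x. norm (T x) = norm x) \<and> surj T}"

definition isometry_group :: "('a::complex_banach \<Rightarrow> 'a) monoid"
  where "isometry_group = \<lparr>carrier = invertible_isometries, mult = (\<circ>), one = id\<rparr>"

lemma group_isometry_group: "group (isometry_group :: ('a::complex_banach \<Rightarrow> 'a) monoid)"
proof (rule groupI, unfold isometry_group_def partial_object.simps monoid.simps)
  fix S T :: "'a \<Rightarrow> 'a"
  assume S: "S \<in> invertible_isometries" and T: "T \<in> invertible_isometries"
  then show "S \<circ> T \<in> invertible_isometries"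
    unfolding invertible_isometries_def bounded_clinear_def
    using comp_surj[of T S] bounded_linear_compose[of S T] by (auto simp: comp_def)
next
  show "id \<in> (invertible_isometries :: ('a \<Rightarrow> 'a) set)"
    by (simp add: invertible_isometries_def bounded_clinear_def id_def bounded_linear_ident)
next
  fix T :: "'a \<Rightarrow> 'a"
  assume "T \<in> invertible_isometries"
  then have bl: "bounded_linear T" and cl: "\<And>c x. T (c *\<^sub>C x) = c *\<^sub>C T x"
    and iso: "\<And>x. norm (T x) = norm x" and sj: "surj T"
    by (auto simp: invertible_isometries_def bounded_clinear_def)
  interpret T: bounded_linear T by (rule bl)
  have inj: "inj T"
  proof (rule injI)
    fix x y assume "T x = T y"
    then have "norm (x - y) = 0" using iso[of "x - y"] by (simp add: T.diff)
    then show "x = y" by simp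
  qed
  let ?S = "inv_into UNIV T"
  have TS: "T (?S x) = x" for x by (rule surj_f_inv_f[OF sj])
  have ST: "?S (T x) = x" for x by (rule inv_f_f[OF inj])
  have "bounded_linear ?S"
  proof (rule bounded_linear_intro[where K = 1])
    show "?S (x + y) = ?S x + ?S y" for x y by (metis ST TS T.add)
    show "?S (r *\<^sub>R x) = r *\<^sub>R ?S x" for r x by (metis ST TS T.scaleR)
    show "norm (?S x) \<le> norm x * 1" for x by (metis TS iso mult.right_neutral order_refl)
  qed
  moreover have "?S (c *\<^sub>C x) = c *\<^sub>C ?S x" for c x by (metis ST TS cl)
  moreover have "norm (?S x) = norm x" for x by (metis TS iso)
  moreover have "surj ?S" by (rule surjI[of _ T]) (rule ST)
  ultimately show "\<exists>S\<in>invertible_isometries. S \<circ> T = id"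
    by (intro bexI[of _ ?S])
       (auto simp: invertible_isometries_def bounded_clinear_def ST fun_eq_iff)
qed (simp_all add: comp_assoc)

definition invertible_isometric_rep ::
    "('g, 'm) monoid_scheme \<Rightarrow> ('g \<Rightarrow> 'a::complex_banach \<Rightarrow> 'a) \<Rightarrow> bool"
  where "invertible_isometric_rep G \<pi> \<longleftrightarrow> \<pi> \<in> hom G isometry_group"

section \<open>The sequence space of a group\<close>

text \<open>A scalar family indexed by \<open>carrier G\<close> is a total function on the ambient type that
  vanishes off the carrier, so that equality of families is equality of functions.\<close>

definition lp_space :: "('g, 'm) monoid_scheme \<Rightarrow> real \<Rightarrow> ('g \<Rightarrow> complex) set"
  where "lp_space G p =
    {a. (\<forall>g. g \<notin> carrier G \<longrightarrow> a g = 0) \<and> (\<lambda>g. cmod (a g) powr p) summable_on carrier G}"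

definition lp_norm :: "('g, 'm) monoid_scheme \<Rightarrow> real \<Rightarrow> ('g \<Rightarrow> complex) \<Rightarrow> real"
  where "lp_norm G p a = (\<Sum>\<^sub>\<infinity>g\<in>carrier G. cmod (a g) powr p) powr (1 / p)"

definition bounded_clinear_on_lp ::
    "('g, 'm) monoid_scheme \<Rightarrow> real \<Rightarrow> (('g \<Rightarrow> complex) \<Rightarrow> 'a::complex_banach) \<Rightarrow> bool"
  where "bounded_clinear_on_lp G p T \<longleftrightarrow>
    (\<forall>a\<in>lp_space G p. \<forall>b\<in>lp_space G p. T (\<lambda>g. a g + b g) = T a + T b) \<and>
    (\<forall>c. \<forall>a\<in>lp_space G p. T (\<lambda>g. c * a g) = c *\<^sub>C T a) \<and>
    (\<exists>C. \<forall>a\<in>lp_space G p. norm (T a) \<le> C * lp_norm G p a)"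

definition std_basis :: "'g \<Rightarrow> 'g \<Rightarrow> complex"
  where "std_basis h = (\<lambda>g. if g = h then 1 else 0)"

definition matrix_of_op :: "(('g \<Rightarrow> complex) \<Rightarrow> 'g \<Rightarrow> complex) \<Rightarrow> 'g \<Rightarrow> 'g \<Rightarrow> complex"
  where "matrix_of_op T g h = T (std_basis h) g"

section \<open>Unconditional Schauder frames\<close>

text \<open>Families \<open>f\<close> and \<open>\<tau>\<close> only matter on \<open>carrier G\<close>. Unconditional convergence is
  convergence along the net of finite subsets of the index set, i.e. \<open>has_sum\<close>.\<close>

definition USF ::
    "('g, 'm) monoid_scheme \<Rightarrow> ('g \<Rightarrow> 'a::complex_banach \<Rightarrow> complex) \<Rightarrow> ('g \<Rightarrow> 'a) \<Rightarrow> bool"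
  where "USF G f \<tau> \<longleftrightarrow>
    (\<forall>g\<in>carrier G. f g \<in> dual) \<and>
    (\<forall>x. ((\<lambda>g. f g x *\<^sub>C \<tau> g) has_sum x) (carrier G))"

definition analysis_op ::
    "('g, 'm) monoid_scheme \<Rightarrow> ('g \<Rightarrow> 'a::complex_banach \<Rightarrow> complex) \<Rightarrow> 'a \<Rightarrow> 'g \<Rightarrow> complex"
  where "analysis_op G f x = (\<lambda>g. if g \<in> carrier G then f g x else 0)"

definition synthesis_op ::
    "('g, 'm) monoid_scheme \<Rightarrow> ('g \<Rightarrow> 'a::complex_banach) \<Rightarrow> ('g \<Rightarrow> complex) \<Rightarrow> 'a"
  where "synthesis_op G \<tau> a = (\<Sum>\<^sub>\<infinity>g\<in>carrier G. a g *\<^sub>C \<tau> g)"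

text \<open>Linearity of the analysis operator is automatic since each \<open>f g\<close> is linear, so being
  an isometry means preserving norms. The synthesis operator is well defined if its series
  converges (unconditionally) for every sequence in the space.\<close>

definition p_USF ::
    "('g, 'm) monoid_scheme \<Rightarrow> real \<Rightarrow> ('g \<Rightarrow> 'a::complex_banach \<Rightarrow> complex) \<Rightarrow> ('g \<Rightarrow> 'a) \<Rightarrow> bool"
  where "p_USF G p f \<tau> \<longleftrightarrow>
    USF G f \<tau> \<and>
    (\<forall>x. analysis_op G f x \<in> lp_space G p \<and> lp_norm G p (analysis_op G f x) = norm x) \<and>
    (\<forall>a\<in>lp_space G p. (\<lambda>g. a g *\<^sub>C \<tau> g) summable_on carrier G) \<and>
    bounded_clinear_on_lp G p (synthesis_op G \<tau>)"

definition group_p_USF ::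
    "('g, 'm) monoid_scheme \<Rightarrow> real \<Rightarrow> ('g \<Rightarrow> 'a::complex_banach \<Rightarrow> complex) \<Rightarrow> ('g \<Rightarrow> 'a) \<Rightarrow> bool"
  where "group_p_USF G p f \<tau> \<longleftrightarrow>
    p_USF G p f \<tau> \<and>
    (\<exists>\<pi> \<tau>\<^sub>0 f\<^sub>0. invertible_isometric_rep G \<pi> \<and> f\<^sub>0 \<in> dual \<and>
      (\<forall>g\<in>carrier G. f g = f\<^sub>0 \<circ> \<pi> (inv\<^bsub>G\<^esub> g) \<and> \<tau> g = \<pi> g \<tau>\<^sub>0))"

definition gramian ::
    "('g, 'm) monoid_scheme \<Rightarrow> ('g \<Rightarrow> 'a::complex_banach \<Rightarrow> complex) \<Rightarrow> ('g \<Rightarrow> 'a)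
      \<Rightarrow> ('g \<Rightarrow> complex) \<Rightarrow> 'g \<Rightarrow> complex"
  where "gramian G f \<tau> = analysis_op G f \<circ> synthesis_op G \<tau>"

definition group_matrix :: "('g, 'm) monoid_scheme \<Rightarrow> ('g \<Rightarrow> 'g \<Rightarrow> complex) \<Rightarrow> bool"
  where "group_matrix G a \<longleftrightarrow>
    (\<exists>\<nu>. \<forall>g\<in>carrier G. \<forall>h\<in>carrier G. a g h = \<nu> (inv\<^bsub>G\<^esub> g \<otimes>\<^bsub>G\<^esub> h))"

end

theory Submission
  imports Defs
begin

text \<open>A group-matrix is exactly a matrix that is unchanged when the same left translation is
  applied to both indices, and the Gramian of a frame has entries \<open>f g (\<tau> h)\<close>. For a frame that
  is an orbit of a representation \<open>\<pi>\<close> the entries are \<open>f\<^sub>0 (\<pi> (g\<^sup>-\<^sup>1h) \<tau>\<^sub>0)\<close>, which settles one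
  direction.

  For the converse, transport left translation from \<open>\<ell>\<^sup>p(G)\<close> to the Banach space: put
  \<open>\<pi>\<^sub>g = \<theta>\<^sub>\<tau> L\<^sub>g \<theta>\<^sub>f\<close>, where \<open>L\<^sub>g\<close> translates sequences by \<open>g\<close>. Invariance of the Gramian says
  that \<open>\<theta>\<^sub>f \<theta>\<^sub>\<tau>\<close> commutes with \<open>L\<^sub>g\<close>, whence the intertwining relation
  \<open>\<theta>\<^sub>f \<pi>\<^sub>g = \<theta>\<^sub>f \<theta>\<^sub>\<tau> L\<^sub>g \<theta>\<^sub>f = L\<^sub>g \<theta>\<^sub>f \<theta>\<^sub>\<tau> \<theta>\<^sub>f = L\<^sub>g \<theta>\<^sub>f\<close>,
  because \<open>\<theta>\<^sub>\<tau> \<theta>\<^sub>f\<close> is the identity (lemma \<open>coefficient_rep\<close>). Since \<open>\<theta>\<^sub>f\<close> is linear, isometric and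
  injective, every remaining claim can be tested on coefficients, where it is evident for \<open>L\<^sub>g\<close>:
  the maps \<open>\<pi>\<^sub>g\<close> are linear isometries, they multiply as the group does, they carry \<open>\<tau>\<^sub>h\<close> to
  \<open>\<tau>\<^sub>g\<^sub>h\<close>, and \<open>f\<^sub>1 \<pi>\<^sub>g\<^sup>-\<^sup>1 = f\<^sub>g\<close>. Invertibility of \<open>\<pi>\<^sub>g\<close> comes for free from multiplicativity and
  \<open>\<pi>\<^sub>1 = id\<close>.\<close>

section \<open>Gramians and group-matrices\<close>

lemma scaleC_zero_left [simp]: "0 *\<^sub>C (x::'a::complex_banach) = 0"
  using scaleC_of_real[of 0 x] by simp

lemma synthesis_std_basis:
  assumes "h \<in> carrier G"
  shows "synthesis_op G \<tau> (std_basis h) = \<tau> h"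
proof -
  have "synthesis_op G \<tau> (std_basis h) = (\<Sum>\<^sub>\<infinity>g\<in>{h}. std_basis h g *\<^sub>C \<tau> g)"
    unfolding synthesis_op_def
    by (rule infsum_cong_neutral) (use assms in \<open>auto simp: std_basis_def\<close>)
  then show ?thesis by (simp add: std_basis_def scaleC_one)
qed

lemma matrix_gramian:
  assumes "g \<in> carrier G" "h \<in> carrier G"
  shows "matrix_of_op (gramian G f \<tau>) g h = f g (\<tau> h)"
  using assms by (simp add: matrix_of_op_def gramian_def analysis_op_def synthesis_std_basis)

lemma (in group) inv_mult_left_cancel:
  assumes "k \<in> carrier G" "g \<in> carrier G" "h \<in> carrier G"
  shows "inv (k \<otimes> g) \<otimes> (k \<otimes> h) = inv g \<otimes> h"
proof -
  have "inv k \<otimes> (k \<otimes> h) = h"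
    using assms by (simp add: m_assoc[symmetric])
  then show ?thesis
    using assms by (simp add: inv_mult_group m_assoc)
qed

text \<open>The function \<open>\<nu>\<close> is recovered as the row of the identity.\<close>

lemma (in group) group_matrix_iff_left_invariant:
  "group_matrix G a \<longleftrightarrow>
    (\<forall>k\<in>carrier G. \<forall>g\<in>carrier G. \<forall>h\<in>carrier G. a (k \<otimes> g) (k \<otimes> h) = a g h)"
proof
  assume "group_matrix G a"
  then obtain \<nu> where \<nu>: "\<And>g h. g \<in> carrier G \<Longrightarrow> h \<in> carrier G \<Longrightarrow> a g h = \<nu> (inv g \<otimes> h)"
    unfolding group_matrix_def by blast
  then show "\<forall>k\<in>carrier G. \<forall>g\<in>carrier G. \<forall>h\<in>carrier G. a (k \<otimes> g) (k \<otimes> h) = a g h"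
    by (simp add: \<nu> inv_mult_left_cancel)
next
  assume inv: "\<forall>k\<in>carrier G. \<forall>g\<in>carrier G. \<forall>h\<in>carrier G. a (k \<otimes> g) (k \<otimes> h) = a g h"
  have "a g h = a \<one> (inv g \<otimes> h)" if "g \<in> carrier G" "h \<in> carrier G" for g h
    using inv[rule_format, of "inv g" g h] that by simp
  then show "group_matrix G a"
    unfolding group_matrix_def by (intro exI[of _ "a \<one>"]) blast
qed

lemma (in group) group_p_USF_gramian_left_invariant:
  assumes "group_p_USF G p f \<tau>" and k: "k \<in> carrier G" and g: "g \<in> carrier G" and h: "h \<in> carrier G"
  shows "f (k \<otimes> g) (\<tau> (k \<otimes> h)) = f g (\<tau> h)"
proof -
  obtain \<pi> \<tau>\<^sub>0 f\<^sub>0 where \<pi>: "\<pi> \<in> hom G isometry_group"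
    and orbit: "\<And>g. g \<in> carrier G \<Longrightarrow> f g = f\<^sub>0 \<circ> \<pi> (inv g) \<and> \<tau> g = \<pi> g \<tau>\<^sub>0"
    using assms(1) unfolding group_p_USF_def invertible_isometric_rep_def by blast
  have mult: "\<pi> x (\<pi> y z) = \<pi> (x \<otimes> y) z" if "x \<in> carrier G" "y \<in> carrier G" for x y z
    using hom_mult[OF \<pi> that] by (simp add: isometry_group_def)
  have entry: "f x (\<tau> y) = f\<^sub>0 (\<pi> (inv x \<otimes> y) \<tau>\<^sub>0)" if "x \<in> carrier G" "y \<in> carrier G" for x y
    using that by (simp add: orbit mult)
  show ?thesis
    using k g h by (simp add: entry inv_mult_left_cancel)
qed

section \<open>Left translation on the sequence space\<close>

definition left_translate ::
    "('g, 'm) monoid_scheme \<Rightarrow> 'g \<Rightarrow> ('g \<Rightarrow> complex) \<Rightarrow> 'g \<Rightarrow> complex"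
  where "left_translate G g a = (\<lambda>h. if h \<in> carrier G then a (inv\<^bsub>G\<^esub> g \<otimes>\<^bsub>G\<^esub> h) else 0)"

lemma (in group) bij_betw_left_mult:
  assumes "g \<in> carrier G"
  shows "bij_betw (\<lambda>h. g \<otimes> h) (carrier G) (carrier G)"
  by (rule bij_betw_byWitness[where f' = "\<lambda>h. inv g \<otimes> h"])
     (use assms in \<open>auto simp: m_assoc[symmetric]\<close>)

lemma (in group) left_translate_in_lp_space:
  assumes g: "g \<in> carrier G" and a: "a \<in> lp_space G p"
  shows "left_translate G g a \<in> lp_space G p"
proof -
  have "(\<lambda>h. cmod (a (inv g \<otimes> h)) powr p) summable_on carrier G"
    using a summable_on_reindex_bij_betw[OF bij_betw_left_mult[of "inv g"],
        of "\<lambda>h. cmod (a h) powr p"] g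
    by (simp add: lp_space_def)
  then have "(\<lambda>h. cmod (left_translate G g a h) powr p) summable_on carrier G"
    by (rule summable_on_cong[THEN iffD1, rotated]) (simp add: left_translate_def)
  then show ?thesis
    by (simp add: lp_space_def left_translate_def)
qed

lemma (in group) lp_norm_left_translate:
  assumes g: "g \<in> carrier G"
  shows "lp_norm G p (left_translate G g a) = lp_norm G p a"
proof -
  have "(\<Sum>\<^sub>\<infinity>h\<in>carrier G. cmod (left_translate G g a h) powr p)
      = (\<Sum>\<^sub>\<infinity>h\<in>carrier G. cmod (a (inv g \<otimes> h)) powr p)"
    by (rule infsum_cong) (simp add: left_translate_def)
  also have "\<dots> = (\<Sum>\<^sub>\<infinity>h\<in>carrier G. cmod (a h) powr p)"
    using infsum_reindex_bij_betw[OF bij_betw_left_mult[of "inv g"],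
        of "\<lambda>h. cmod (a h) powr p"] g by simp
  finally show ?thesis
    by (simp add: lp_norm_def)
qed

section \<open>The representation of a frame with invariant Gramian\<close>

locale left_invariant_p_USF = group G
  for G :: "('g, 'm) monoid_scheme" (structure)
    and p :: real
    and f :: "'g \<Rightarrow> 'a::complex_banach \<Rightarrow> complex"
    and \<tau> :: "'g \<Rightarrow> 'a" +
  assumes frame: "p_USF G p f \<tau>"
    and left_invariant: "\<lbrakk>k \<in> carrier G; g \<in> carrier G; h \<in> carrier G\<rbrakk>
      \<Longrightarrow> f (k \<otimes> g) (\<tau> (k \<otimes> h)) = f g (\<tau> h)"
begin

definition rep :: "'g \<Rightarrow> 'a \<Rightarrow> 'a"
  where "rep g x = synthesis_op G \<tau> (left_translate G g (analysis_op G f x))"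

lemma expansion: "((\<lambda>g. f g x *\<^sub>C \<tau> g) has_sum x) (carrier G)"
  using frame by (auto simp: p_USF_def USF_def)

lemma coefficient_dual: "g \<in> carrier G \<Longrightarrow> f g \<in> dual"
  using frame by (auto simp: p_USF_def USF_def)

lemma coefficient_bounded_linear: "g \<in> carrier G \<Longrightarrow> bounded_linear (f g)"
  using coefficient_dual[of g] by (simp add: dual_def bounded_clinear_def)

lemma coefficient_scaleC: "g \<in> carrier G \<Longrightarrow> f g (c *\<^sub>C x) = c * f g x"
  using coefficient_dual[of g] by (simp add: dual_def bounded_clinear_def scaleC_complex_def)

lemma analysis_in_lp_space: "analysis_op G f x \<in> lp_space G p"
  and lp_norm_analysis: "lp_norm G p (analysis_op G f x) = norm x"
  using frame by (auto simp: p_USF_def)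

lemma eqI_coefficients:
  assumes "\<And>k. k \<in> carrier G \<Longrightarrow> f k x = f k y"
  shows "x = y"
proof (rule has_sum_unique[OF expansion])
  show "((\<lambda>g. f g x *\<^sub>C \<tau> g) has_sum y) (carrier G)"
    by (rule has_sum_cong[THEN iffD1, OF _ expansion]) (simp add: assms)
qed

text \<open>This is \<open>\<theta>\<^sub>f \<pi>\<^sub>g = L\<^sub>g \<theta>\<^sub>f\<close> read coordinatewise. Applying the continuous functional \<open>f k\<close>
  to the series defining \<open>rep g x\<close> and shifting the summation index by \<open>g\<close> gives a series with
  terms \<open>f h x * f k (\<tau> (g h))\<close>; invariance replaces the second factor by \<open>f (g\<^sup>-\<^sup>1k) (\<tau> h)\<close>, and
  what results is \<open>f (g\<^sup>-\<^sup>1k)\<close> applied to the frame expansion of \<open>x\<close>.\<close>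

lemma coefficient_rep:
  assumes g: "g \<in> carrier G" and k: "k \<in> carrier G"
  shows "f k (rep g x) = f (inv g \<otimes> k) x"
proof -
  let ?a = "left_translate G g (analysis_op G f x)"
  have "?a \<in> lp_space G p"
    by (rule left_translate_in_lp_space[OF g analysis_in_lp_space])
  then have "((\<lambda>h. ?a h *\<^sub>C \<tau> h) has_sum rep g x) (carrier G)"
    using frame unfolding rep_def synthesis_op_def p_USF_def by (intro has_sum_infsum) blast
  from has_sum_bounded_linear[OF coefficient_bounded_linear[OF k] this]
  have "((\<lambda>h. ?a h * f k (\<tau> h)) has_sum f k (rep g x)) (carrier G)"
    by (simp add: coefficient_scaleC[OF k] o_def)
  then have "((\<lambda>h. ?a (g \<otimes> h) * f k (\<tau> (g \<otimes> h))) has_sum f k (rep g x)) (carrier G)"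
    using has_sum_reindex_bij_betw[OF bij_betw_left_mult[OF g], of "\<lambda>h. ?a h * f k (\<tau> h)"]
    by simp
  moreover have "?a (g \<otimes> h) * f k (\<tau> (g \<otimes> h)) = f h x * f (inv g \<otimes> k) (\<tau> h)"
    if h: "h \<in> carrier G" for h
  proof -
    have "f k (\<tau> (g \<otimes> h)) = f (inv g \<otimes> k) (\<tau> h)"
      using left_invariant[of g "inv g \<otimes> k" h] g k h by (simp add: m_assoc[symmetric])
    moreover have "?a (g \<otimes> h) = f h x"
      using g h by (simp add: left_translate_def analysis_op_def m_assoc[symmetric])
    ultimately show ?thesis by simp
  qed
  ultimately have "((\<lambda>h. f h x * f (inv g \<otimes> k) (\<tau> h)) has_sum f k (rep g x)) (carrier G)"
    by (simp cong: has_sum_cong)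
  moreover have "((\<lambda>h. f h x * f (inv g \<otimes> k) (\<tau> h)) has_sum f (inv g \<otimes> k) x) (carrier G)"
  proof -
    have gk: "inv g \<otimes> k \<in> carrier G" using g k by simp
    show ?thesis
      using has_sum_bounded_linear[OF coefficient_bounded_linear[OF gk] expansion[of x]]
      by (simp add: coefficient_scaleC[OF gk] o_def)
  qed
  ultimately show ?thesis by (rule has_sum_unique)
qed

lemma analysis_rep:
  assumes "g \<in> carrier G"
  shows "analysis_op G f (rep g x) = left_translate G g (analysis_op G f x)"
  using assms by (auto simp: analysis_op_def left_translate_def coefficient_rep)

lemma norm_rep:
  assumes "g \<in> carrier G"
  shows "norm (rep g x) = norm x"
  by (metis analysis_rep[OF assms] lp_norm_analysis lp_norm_left_translate[OF assms])

lemma rep_mult: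
  assumes g: "g \<in> carrier G" and h: "h \<in> carrier G"
  shows "rep (g \<otimes> h) x = rep g (rep h x)"
  by (rule eqI_coefficients) (use g h in \<open>simp add: coefficient_rep inv_mult_group m_assoc\<close>)

lemma rep_one: "rep \<one> x = x"
  by (rule eqI_coefficients) (simp add: coefficient_rep)

lemma bounded_clinear_rep:
  assumes g: "g \<in> carrier G"
  shows "bounded_clinear (rep g)"
proof -
  have coeff: "bounded_linear (f (inv g \<otimes> k))" "bounded_linear (f k)" if "k \<in> carrier G" for k
    using g that by (auto intro: coefficient_bounded_linear)
  have "bounded_linear (rep g)"
  proof (rule bounded_linear_intro[where K = 1])
    show "rep g (x + y) = rep g x + rep g y" for x y
      by (rule eqI_coefficients)
         (simp add: coefficient_rep[OF g] linear_add coeff[THEN bounded_linear.linear])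
    show "rep g (r *\<^sub>R x) = r *\<^sub>R rep g x" for r x
      by (rule eqI_coefficients)
         (simp add: coefficient_rep[OF g] linear_scale coeff[THEN bounded_linear.linear])
    show "norm (rep g x) \<le> norm x * 1" for x
      by (simp add: norm_rep[OF g])
  qed
  moreover have "rep g (c *\<^sub>C x) = c *\<^sub>C rep g x" for c x
    by (rule eqI_coefficients) (use g in \<open>simp add: coefficient_rep coefficient_scaleC\<close>)
  ultimately show ?thesis
    by (simp add: bounded_clinear_def)
qed

lemma invertible_isometric_rep_rep: "invertible_isometric_rep G rep"
proof -
  have "surj (rep g)" if g: "g \<in> carrier G" for g
  proof (rule surjI)
    show "rep g (rep (inv g) x) = x" for x
      using rep_mult[of g "inv g" x] g by (simp add: rep_one)
  qed
  then have "rep g \<in> invertible_isometries" if "g \<in> carrier G" for g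
    using that by (simp add: invertible_isometries_def bounded_clinear_rep norm_rep)
  then show ?thesis
    by (auto simp: invertible_isometric_rep_def isometry_group_def hom_def fun_eq_iff rep_mult)
qed

lemma rep_frame_vector:
  assumes g: "g \<in> carrier G" and h: "h \<in> carrier G"
  shows "rep g (\<tau> h) = \<tau> (g \<otimes> h)"
proof (rule eqI_coefficients)
  fix k assume k: "k \<in> carrier G"
  show "f k (rep g (\<tau> h)) = f k (\<tau> (g \<otimes> h))"
    using left_invariant[of g "inv g \<otimes> k" h] g h k
    by (simp add: coefficient_rep m_assoc[symmetric])
qed

lemma group_p_USF_frame: "group_p_USF G p f \<tau>"
proof -
  have "f g = f \<one> \<circ> rep (inv g) \<and> \<tau> g = rep g (\<tau> \<one>)" if "g \<in> carrier G" for g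
    using that by (auto simp: coefficient_rep rep_frame_vector)
  then show ?thesis
    unfolding group_p_USF_def
    using frame invertible_isometric_rep_rep coefficient_dual[OF one_closed] by blast
qed

end

section \<open>Characterisation of group frames\<close>

theorem theorem2p10:
  fixes G :: "('g, 'm) monoid_scheme"
    and p :: real
    and f :: "'g \<Rightarrow> 'a::complex_banach \<Rightarrow> complex"
    and \<tau> :: "'g \<Rightarrow> 'a"
  assumes "group G" and "countable (carrier G)"
    and "1 \<le> p"
    and "separable_space (euclidean :: 'a topology)"
    and "p_USF G p f \<tau>"
  shows "(\<forall>g\<in>carrier G. \<forall>h\<in>carrier G. matrix_of_op (gramian G f \<tau>) g h = f g (\<tau> h)) \<and>
    (group_p_USF G p f \<tau> \<longleftrightarrow> group_matrix G (matrix_of_op (gramian G f \<tau>)))"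
proof -
  interpret group G by (rule assms(1))
  have "group_matrix G (matrix_of_op (gramian G f \<tau>)) \<longleftrightarrow>
      (\<forall>k\<in>carrier G. \<forall>g\<in>carrier G. \<forall>h\<in>carrier G.
        f (k \<otimes>\<^bsub>G\<^esub> g) (\<tau> (k \<otimes>\<^bsub>G\<^esub> h)) = f g (\<tau> h))"
    (is "_ \<longleftrightarrow> ?invariant")
    by (simp add: group_matrix_iff_left_invariant matrix_gramian)
  moreover have "group_p_USF G p f \<tau> \<longleftrightarrow> ?invariant"
  proof
    assume "group_p_USF G p f \<tau>"
    then show ?invariant by (simp add: group_p_USF_gramian_left_invariant)
  next
    assume ?invariant
    then interpret left_invariant_p_USF G p f \<tau>
      using assms(5) by unfold_locales auto
    show "group_p_USF G p f \<tau>" by (rule group_p_USF_frame)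
  qed
  ultimately show ?thesis by (simp add: matrix_gramian)
qed

end
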